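(* Every non-discrete Tychonoff $P$-space $X$ is sequentially Ascoli but not weakly open-compact attainable.
   Context: All topological spaces are assumed to be Tychonoff. A space $X$ is a $P$-space if the intersection of any countably many open sets is open. $C_k(X)$ denotes the space of all continuous real-valued functions on $X$ with the compact-open topology. $X$ is sequentially Ascoli if every convergent sequence in $C_k(X)$ is equicontinuous. $X$ is weakly open-compact attainable if for every non-closed open subset $W$ of $X$ there are a point $z\in\overline{W}\setminus W$ and a compact subset $K$ of $X$ such that $z\in K\cap\overline{K\cap W}$. *)

theory Defs
  imports "HOL-Analysis.Analysis"
begin

definition Tychonoff_space :: "'a topology \<Rightarrow> bool" where
  "Tychonoff_space X \<longleftrightarrow> completely_regular_space X \<and> Hausdorff_space X"

(* The empty family is excluded because \<Inter>{} = UNIV need not be contained in topspace X. *)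
definition P_space :: "'a topology \<Rightarrow> bool" where
  "P_space X \<longleftrightarrow>
     (\<forall>\<U>. countable \<U> \<and> \<U> \<noteq> {} \<and> (\<forall>U\<in>\<U>. openin X U) \<longrightarrow> openin X (\<Inter>\<U>))"

(* Functions on the space X are represented by functions on the type 'a that are
   extensional, so that two of them are equal iff they agree on topspace X. *)
definition real_continuous_functions :: "'a topology \<Rightarrow> ('a \<Rightarrow> real) set" where
  "real_continuous_functions X =
     {f \<in> extensional (topspace X). continuous_map X euclideanreal f}"

definition compact_open_topology :: "'a topology \<Rightarrow> ('a \<Rightarrow> real) topology" where
  "compact_open_topology X =
     topology_generated_by
       {{f \<in> real_continuous_functions X. f ` K \<subseteq> U} | K U. compactin X K \<and> open U}"

lemma topspace_compact_open_topology [simp]: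
  "topspace (compact_open_topology X) = real_continuous_functions X"
  unfolding compact_open_topology_def by fastforce

definition equicontinuous_family :: "'a topology \<Rightarrow> ('a \<Rightarrow> real) set \<Rightarrow> bool" where
  "equicontinuous_family X F \<longleftrightarrow>
     (\<forall>x\<in>topspace X. \<forall>\<epsilon>>0. \<exists>U. openin X U \<and> x \<in> U \<and>
        (\<forall>f\<in>F. \<forall>y\<in>U. \<bar>f y - f x\<bar> < \<epsilon>))"

(* limitin constrains only a tail of the sequence, hence the explicit membership of all terms. *)
definition sequentially_Ascoli :: "'a topology \<Rightarrow> bool" where
  "sequentially_Ascoli X \<longleftrightarrow>
     (\<forall>f g. range f \<subseteq> real_continuous_functions X \<and>
        limitin (compact_open_topology X) f g sequentially \<longrightarrow>
        equicontinuous_family X (range f))"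

definition weakly_open_compact_attainable :: "'a topology \<Rightarrow> bool" where
  "weakly_open_compact_attainable X \<longleftrightarrow>
     (\<forall>W. openin X W \<and> \<not> closedin X W \<longrightarrow>
        (\<exists>z K. z \<in> X closure_of W - W \<and> compactin X K \<and>
           z \<in> K \<inter> X closure_of (K \<inter> W)))"

end

theory Submission
  imports Defs
begin

text \<open>In a $P$-space every countable set of continuous functions is equicontinuous, since the
  countably many neighbourhoods witnessing continuity can be intersected. Dually, countable subsets
  of a $T_1$ $P$-space are closed, hence without accumulation points, so compact sets are finite.
  A finite set \<open>K \<inter> W\<close> is closed and cannot attain a point outside \<open>W\<close>; and the complement of a
  non-isolated point is open but not closed.\<close>

lemma P_space_equicontinuous_countable:
  assumes "P_space X" and "countable F" and F: "F \<subseteq> real_continuous_functions X"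
  shows "equicontinuous_family X F"
  unfolding equicontinuous_family_def
proof (intro ballI allI impI)
  fix x and \<epsilon> :: real
  assume x: "x \<in> topspace X" and "\<epsilon> > 0"
  define V where "V f = {y \<in> topspace X. f y \<in> ball (f x) \<epsilon>}" for f :: "'a \<Rightarrow> real"
  \<comment> \<open>Adding \<open>topspace X\<close> keeps the family nonempty even for empty
    \<open>F\<close>, as \<open>P_space\<close> demands.\<close>
  define \<U> where "\<U> = insert (topspace X) (V ` F)"
  have "openin X (V f)" if "f \<in> F" for f
    unfolding V_def
    by (rule openin_continuous_map_preimage[where Y = euclideanreal])
      (use that F in \<open>auto simp: real_continuous_functions_def\<close>)
  then have "\<forall>U\<in>\<U>. openin X U"
    by (auto simp: \<U>_def)
  moreover have "countable \<U>" "\<U> \<noteq> {}"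
    using \<open>countable F\<close> by (auto simp: \<U>_def)
  ultimately have "openin X (\<Inter>\<U>)"
    using \<open>P_space X\<close> unfolding P_space_def by blast
  moreover have "x \<in> \<Inter>\<U>"
    using x \<open>\<epsilon> > 0\<close> by (auto simp: \<U>_def V_def)
  moreover have "\<forall>f\<in>F. \<forall>y\<in>\<Inter>\<U>. \<bar>f y - f x\<bar> < \<epsilon>"
    by (auto simp: \<U>_def V_def dist_real_def abs_minus_commute)
  ultimately show "\<exists>U. openin X U \<and> x \<in> U \<and> (\<forall>f\<in>F. \<forall>y\<in>U. \<bar>f y - f x\<bar> < \<epsilon>)"
    by blast
qed

text \<open>The complement of \<open>A\<close> is the intersection of the complements of its points,
  which are countably many open sets.\<close>

lemma P_space_closedin_countable:
  assumes "P_space X" and "t1_space X" and "countable A" and A: "A \<subseteq> topspace X"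
  shows "closedin X A"
proof -
  \<comment> \<open>For empty \<open>A\<close> the intersection is thus \<open>topspace X\<close>
    and not \<open>UNIV\<close>.\<close>
  define \<U> where "\<U> = insert (topspace X) ((\<lambda>a. topspace X - {a}) ` A)"
  have "\<forall>U\<in>\<U>. openin X U"
    using \<open>t1_space X\<close> A by (auto simp: \<U>_def t1_space_closedin_singleton intro!: openin_diff)
  moreover have "countable \<U>" "\<U> \<noteq> {}"
    using \<open>countable A\<close> by (auto simp: \<U>_def)
  ultimately have "openin X (\<Inter>\<U>)"
    using \<open>P_space X\<close> unfolding P_space_def by blast
  moreover have "\<Inter>\<U> = topspace X - A"
    by (auto simp: \<U>_def)
  ultimately show ?thesis
    using A by (simp add: closedin_def)
qed

lemma P_space_compactin_imp_finite:
  assumes "P_space X" and "t1_space X" and "compactin X K"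
  shows "finite K"
proof (rule ccontr)
  assume "infinite K"
  then obtain A where A: "A \<subseteq> K" "countable A" "infinite A"
    using infinite_countable_subset' by metis
  then obtain x where x: "x \<in> X derived_set_of A"
    using compactin_imp_Bolzano_Weierstrass[OF \<open>compactin X K\<close>] by blast
  have "A \<subseteq> topspace X"
    using A \<open>compactin X K\<close> compactin_subset_topspace by blast
  \<comment> \<open>Removing \<open>x\<close> leaves a countable, hence closed, set that misses
    \<open>x\<close>; yet an accumulation point of \<open>A\<close> lies in the closure of
    \<open>A - {x}\<close>.\<close>
  with A have "closedin X (A - {x})"
    by (intro P_space_closedin_countable[OF assms(1,2)]) auto
  then have "X closure_of (A - {x}) = A - {x}"
    by (simp add: closure_of_closedin)
  moreover have "x \<in> X closure_of (A - {x})"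
    using x by (auto simp: in_derived_set_of in_closure_of)
  ultimately show False
    by blast
qed

theorem proposition2p8:
  fixes X :: "'a topology"
  assumes "Tychonoff_space X"
    and "P_space X"
    and "X \<noteq> discrete_topology (topspace X)"
  shows "sequentially_Ascoli X \<and> \<not> weakly_open_compact_attainable X"
proof
  show "sequentially_Ascoli X"
    unfolding sequentially_Ascoli_def
    \<comment> \<open>The range of a sequence is countable.\<close>
    by (simp add: P_space_equicontinuous_countable[OF \<open>P_space X\<close>])
next
  have t1: "t1_space X"
    using assms(1) by (simp add: Tychonoff_space_def Hausdorff_imp_t1_space)
  \<comment> \<open>A space is discrete iff all its singletons are open.\<close>
  obtain x where x: "x \<in> topspace X" "\<not> openin X {x}"
    using assms(3) discrete_topology_unique[of "topspace X" X] by auto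
  define W where "W = topspace X - {x}"
  have "openin X W"
    using t1 x by (simp add: W_def t1_space_closedin_singleton openin_diff)
  moreover have "\<not> closedin X W"
    using x by (simp add: W_def closedin_def Diff_Diff_Int Int_absorb1)
  \<comment> \<open>With this, any \<open>z\<close> in the closure of \<open>K \<inter> W\<close>
    lies in \<open>W\<close>, whereas attainability asks for \<open>z\<close> outside
    \<open>W\<close>.\<close>
  moreover have "X closure_of (K \<inter> W) = K \<inter> W" if "compactin X K" for K
  proof -
    have "finite K" "K \<subseteq> topspace X"
      using P_space_compactin_imp_finite[OF \<open>P_space X\<close> t1] that compactin_subset_topspace by auto
    then show ?thesis
      by (intro closure_of_closedin P_space_closedin_countable[OF \<open>P_space X\<close> t1])
        (auto intro: countable_finite)
  qed
  ultimately show "\<not> weakly_open_compact_attainable X"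
    unfolding weakly_open_compact_attainable_def by (metis DiffD2 IntD2)
qed

end
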